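(* Let $X$ be a locally compact Hausdorff space and let $A$ be a $C_0(X)$-Banach algebra. For every $a\in A$, the function $X\ni x\mapsto\rho_{A_x}(a_x)$ is upper semi-continuous and vanishes at infinity. If $X$ is second countable, then \[ \rho_A(a)=\max_{x\in X}\rho_{A_x}(a_x) \] for all $a\in A$.
   Context: Banach spaces and algebras are complex. A $C_0(X)$-Banach space is a Banach space $E$ with a contractive $C_0(X)$-module structure that is non-degenerate (the span of $C_0(X)E$ is dense in $E$). A $C_0(X)$-Banach algebra is a Banach algebra $A$ that is also a $C_0(X)$-Banach space such that the multiplication is $C_0(X)$-bilinear: $\chi(ab)=(\chi a)b=a(\chi b)$. The fibre of $A$ over $x\in X$ is the quotient Banach algebra $A_x=A/(C_0(X\setminus\{x\})A)$, and $a\mapsto a_x$ denotes the quotient map $A\to A_x$. For a Banach algebra $A$, $\rho_A(a)$ denotes the spectral radius of $a\in A$. *)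

theory Defs
  imports "HOL-Analysis.Analysis" "HOL-Algebra.Group"
begin

section \<open>Complex Banach spaces and Banach algebras\<close>

class scaleC =
  fixes scaleC :: "complex \<Rightarrow> 'a \<Rightarrow> 'a" (infixr \<open>*\<^sub>C\<close> 75)

class complex_banach = banach + scaleC +
  assumes scaleC_add_right: "c *\<^sub>C (a + b) = c *\<^sub>C a + c *\<^sub>C b"
    and scaleC_add_left: "(c + d) *\<^sub>C a = c *\<^sub>C a + d *\<^sub>C a"
    and scaleC_scaleC: "c *\<^sub>C d *\<^sub>C a = (c * d) *\<^sub>C a"
    and scaleC_of_real: "complex_of_real r *\<^sub>C a = r *\<^sub>R a"
    and norm_scaleC: "norm (c *\<^sub>C a) = cmod c * norm a"

text \<open>The class \<open>real_normed_algebra\<close> does not provide a unit, so these Banach algebras need not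
  be unital, and the zero algebra is allowed.\<close>

class complex_banach_algebra = complex_banach + real_normed_algebra +
  assumes mult_scaleC_left: "(c *\<^sub>C a) * b = c *\<^sub>C (a * b)"
    and mult_scaleC_right: "a * (c *\<^sub>C b) = c *\<^sub>C (a * b)"

interpretation complex_vector:
  vector_space "scaleC :: complex \<Rightarrow> 'a \<Rightarrow> 'a::complex_banach"
proof
  show "1 *\<^sub>C a = a" for a :: 'a
    using scaleC_of_real [of 1 a] by simp
qed (simp_all add: scaleC_add_right scaleC_add_left scaleC_scaleC)


section \<open>Functions on a topological space\<close>

definition vanishes_at_infinity :: "('x::topological_space \<Rightarrow> 'b::real_normed_vector) \<Rightarrow> bool" where
  "vanishes_at_infinity f \<longleftrightarrow> (\<forall>e>0. \<exists>K. compact K \<and> (\<forall>x. x \<notin> K \<longrightarrow> norm (f x) < e))"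

definition upper_semicontinuous :: "('x::topological_space \<Rightarrow> real) \<Rightarrow> bool" where
  "upper_semicontinuous f \<longleftrightarrow> (\<forall>c. open {x. f x < c})"

definition C0 :: "('x::topological_space \<Rightarrow> complex) set" where
  "C0 = {f. continuous_on UNIV f \<and> vanishes_at_infinity f}"

definition sup_norm :: "('x \<Rightarrow> complex) \<Rightarrow> real" where
  "sup_norm f = (SUP x. cmod (f x))"


section \<open>\<open>C\<^sub>0(X)\<close>-Banach spaces and \<open>C\<^sub>0(X)\<close>-Banach algebras\<close>

text \<open>The space \<open>X\<close> is the type \<open>'x\<close>. Only the values \<open>act f a\<close> with \<open>f \<in> C0\<close> are meaningful.\<close>

locale C0_banach_space =
  fixes act :: "('x::topological_space \<Rightarrow> complex) \<Rightarrow> 'a::complex_banach \<Rightarrow> 'a"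
  assumes act_add_left: "\<lbrakk>f \<in> C0; g \<in> C0\<rbrakk> \<Longrightarrow> act (\<lambda>x. f x + g x) a = act f a + act g a"
    and act_scale_left: "f \<in> C0 \<Longrightarrow> act (\<lambda>x. c * f x) a = c *\<^sub>C act f a"
    and act_add_right: "f \<in> C0 \<Longrightarrow> act f (a + b) = act f a + act f b"
    and act_scale_right: "f \<in> C0 \<Longrightarrow> act f (c *\<^sub>C a) = c *\<^sub>C act f a"
    and act_mult: "\<lbrakk>f \<in> C0; g \<in> C0\<rbrakk> \<Longrightarrow> act (\<lambda>x. f x * g x) a = act f (act g a)"
    and act_contractive: "f \<in> C0 \<Longrightarrow> norm (act f a) \<le> sup_norm f * norm a"
    and act_nondegenerate: "closure (complex_vector.span {act f a | f a. f \<in> C0}) = UNIV"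

locale C0_banach_algebra = C0_banach_space act
  for act :: "('x::topological_space \<Rightarrow> complex) \<Rightarrow> 'a::complex_banach_algebra \<Rightarrow> 'a" +
  assumes act_mult_left: "f \<in> C0 \<Longrightarrow> act f (a * b) = act f a * b"
    and act_mult_right: "f \<in> C0 \<Longrightarrow> act f (a * b) = a * act f b"


section \<open>Normed algebras with explicit carrier, and the spectral radius\<close>

text \<open>Fibres depend on a point of \<open>X\<close> and hence are not types; they are instances of the following
  record, and so is the algebra on a whole type.\<close>

record 'a normed_alg = "'a partial_object" +
  alg_zero :: 'a
  alg_add :: "'a \<Rightarrow> 'a \<Rightarrow> 'a"
  alg_mult :: "'a \<Rightarrow> 'a \<Rightarrow> 'a"
  alg_scale :: "complex \<Rightarrow> 'a \<Rightarrow> 'a"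
  alg_norm :: "'a \<Rightarrow> real"

definition type_alg :: "'a::complex_banach_algebra normed_alg" where
  "type_alg = \<lparr>carrier = UNIV, alg_zero = 0, alg_add = (+), alg_mult = (*),
     alg_scale = (*\<^sub>C), alg_norm = norm\<rparr>"

text \<open>The pair \<open>(a, c)\<close> stands for \<open>a + c \<cdot> 1\<close>.\<close>

definition unitization :: "('a, 'm) normed_alg_scheme \<Rightarrow> ('a \<times> complex) monoid" where
  "unitization A = \<lparr>carrier = carrier A \<times> UNIV,
     monoid.mult = (\<lambda>(a, c) (b, d).
       (alg_add A (alg_mult A a b) (alg_add A (alg_scale A d a) (alg_scale A c b)), c * d)),
     one = (alg_zero A, 1)\<rparr>"

text \<open>The spectrum is always taken in the unitization: \<open>c\<close> belongs to it iff \<open>c \<cdot> 1 - a\<close> is not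
  invertible there. If \<open>A\<close> already has a unit, this only adds the point \<open>0\<close> to the spectrum
  computed in \<open>A\<close>. Since \<open>0\<close> always belongs to the spectrum, the supremum below is never over the
  empty set, and the spectral radius in the zero algebra is \<open>0\<close>.\<close>

definition spectrum :: "('a, 'm) normed_alg_scheme \<Rightarrow> 'a \<Rightarrow> complex set" where
  "spectrum A a = {c. (alg_scale A (-1) a, c) \<notin> Units (unitization A)}"

definition spectral_radius :: "('a, 'm) normed_alg_scheme \<Rightarrow> 'a \<Rightarrow> real" where
  "spectral_radius A a = (SUP c\<in>spectrum A a. cmod c)"


section \<open>Quotients and fibres\<close>

definition coset :: "'a::complex_banach_algebra set \<Rightarrow> 'a \<Rightarrow> 'a set" where
  "coset I a = (+) a ` I"

definition quotient_alg :: "'a::complex_banach_algebra set \<Rightarrow> 'a set normed_alg" where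
  "quotient_alg I = \<lparr>carrier = range (coset I), alg_zero = I,
     alg_add = (\<lambda>S T. \<Union>s\<in>S. \<Union>t\<in>T. coset I (s + t)),
     alg_mult = (\<lambda>S T. \<Union>s\<in>S. \<Union>t\<in>T. coset I (s * t)),
     alg_scale = (\<lambda>c S. \<Union>s\<in>S. coset I (c *\<^sub>C s)),
     alg_norm = (\<lambda>S. INF s\<in>S. norm s)\<rparr>"

text \<open>\<open>C\<^sub>0(X \<setminus> {x})\<close> is identified, via extension by zero, with the functions in \<open>C\<^sub>0(X)\<close> vanishing
  at \<open>x\<close>, and \<open>C\<^sub>0(X \<setminus> {x})A\<close> denotes the closed linear span of the products.\<close>

definition fibre_ideal ::
  "(('x::topological_space \<Rightarrow> complex) \<Rightarrow> 'a::complex_banach_algebra \<Rightarrow> 'a) \<Rightarrow> 'x \<Rightarrow> 'a set" where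
  "fibre_ideal act x = closure (complex_vector.span {act f a | f a. f \<in> C0 \<and> f x = 0})"

definition fibre ::
  "(('x::topological_space \<Rightarrow> complex) \<Rightarrow> 'a::complex_banach_algebra \<Rightarrow> 'a) \<Rightarrow> 'x \<Rightarrow> 'a set normed_alg" where
  "fibre act x = quotient_alg (fibre_ideal act x)"

definition fibre_map ::
  "(('x::topological_space \<Rightarrow> complex) \<Rightarrow> 'a::complex_banach_algebra \<Rightarrow> 'a) \<Rightarrow> 'x \<Rightarrow> 'a \<Rightarrow> 'a set" where
  "fibre_map act x a = coset (fibre_ideal act x) a"

end

theory Submission
  imports Defs
begin

text \<open>The heart of the matter is that a number \<open>c \<noteq> 0\<close> belongs to the spectrum of \<open>a\<close> in \<open>A\<close> if
  and only if it belongs to the spectrum of \<open>a\<^sub>x\<close> in \<open>A\<^sub>x\<close> for some point \<open>x\<close>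
  (\<open>quasi_invertible_if_fibrewise\<close>). The norm of \<open>A\<close> need not be the supremum of the norms of
  the fibres, so inverses in the fibres cannot be patched together. Instead, suppose that
  \<open>c - a\<close> has no left inverse. Then \<open>e = a/c\<close> is a right unit modulo some maximal modular left
  ideal \<open>M\<close>. Maximality makes \<open>{f. f A \<subseteq> M}\<close> a prime ideal of \<open>C\<^sub>0(X)\<close>
  (\<open>maximal_modular_left_ideal_prime\<close>); it is closed and, as \<open>C\<^sub>0(X) A\<close> spans a dense subspace,
  it is proper. A proper closed prime ideal of \<open>C\<^sub>0(X)\<close> consists of all functions that are zero at some
  point \<open>x\<close>. So the fibre ideal of \<open>x\<close> is contained in \<open>M\<close>
  (\<open>maximal_modular_left_ideal_contains_fibre_ideal\<close>), and \<open>c - a\<^sub>x\<close> has no left inverse in the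
  unitization of \<open>A\<^sub>x\<close>. Applied to \<open>c - a\<close> and then to its left inverse, this yields
  two-sided inverses. The spectrum is compact, so the spectral radius of \<open>a\<close> is the modulus of a
  spectral value, which, unless it is \<open>0\<close>, is also one in some fibre; and no fibre can have a larger one, since
  invertibility passes to quotients.

  As to the behaviour in \<open>x\<close>, the fibre norm of an element is upper semicontinuous and vanishes at infinity (\<open>fibre_ideal_approx_nearby\<close>,
  \<open>fibre_ideal_approx_at_infinity\<close>). The second property passes to the spectral radius because
  that is bounded by the norm. By the first, an inverse at \<open>x\<close> is an approximate inverse at nearby
  points, hence can be corrected to an inverse there, and the tube lemma makes this uniform over
  all \<open>c\<close> with \<open>\<bar>c\<bar> \<ge> r\<close>.\<close>


section \<open>Quasi-inverses modulo an ideal\<close>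

text \<open>Under \<open>a \<mapsto> 1 - a\<close> this is the product of the unitization, since
  \<open>(1 - a)(1 - b) = 1 - (a + b - ab)\<close>. It makes it possible to speak about inverses of
  \<open>1 - a\<close> without leaving a non-unital algebra.\<close>

definition circle :: "'a::ring \<Rightarrow> 'a \<Rightarrow> 'a" (infixl "\<star>" 65) where
  "a \<star> b = a + b - a * b"

lemma circle_assoc: "(a \<star> b) \<star> c = a \<star> (b \<star> c)"
  by (simp add: circle_def algebra_simps)

lemma circle_0 [simp]: "0 \<star> a = a" "a \<star> 0 = a"
  by (simp_all add: circle_def)

lemma circle_add_left: "(a + j) \<star> b = a \<star> b + (j - j * b)"
  by (simp add: circle_def algebra_simps)

lemma circle_add_right: "a \<star> (b + j) = a \<star> b + (j - a * j)"
  by (simp add: circle_def algebra_simps)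

definition two_sided_ideal :: "'a::complex_banach_algebra set \<Rightarrow> bool" where
  "two_sided_ideal I \<longleftrightarrow>
     complex_vector.subspace I \<and> (\<forall>a. \<forall>s\<in>I. a * s \<in> I \<and> s * a \<in> I)"

lemma two_sided_idealD:
  assumes "two_sided_ideal I"
  shows "0 \<in> I"
    and "s \<in> I \<Longrightarrow> t \<in> I \<Longrightarrow> s + t \<in> I"
    and "s \<in> I \<Longrightarrow> t \<in> I \<Longrightarrow> s - t \<in> I"
    and "s \<in> I \<Longrightarrow> c *\<^sub>C s \<in> I"
    and "s \<in> I \<Longrightarrow> a * s \<in> I"
    and "s \<in> I \<Longrightarrow> s * a \<in> I"
  using assms complex_vector.subspace_diff[of I]
  by (auto simp: two_sided_ideal_def complex_vector.subspace_def)

lemma two_sided_ideal_zero: "two_sided_ideal {0}"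
  by (simp add: two_sided_ideal_def complex_vector.subspace_def)

definition quasi_invertible :: "'a::complex_banach_algebra set \<Rightarrow> 'a \<Rightarrow> bool" where
  "quasi_invertible I e \<longleftrightarrow> (\<exists>d. d \<star> e \<in> I) \<and> (\<exists>d. e \<star> d \<in> I)"

text \<open>In a monoid a left inverse and a right inverse coincide; here this holds modulo \<open>I\<close>, so
  each of the two is inverse to \<open>e\<close> on both sides.\<close>

lemma left_quasi_inverse_is_right:
  assumes I: "two_sided_ideal I" and f: "f \<star> e \<in> I" and g: "e \<star> g \<in> I"
  shows "e \<star> f \<in> I"
proof -
  note Id = two_sided_idealD[OF I]
  have "f + (e \<star> g - f * (e \<star> g)) = g + (f \<star> e - (f \<star> e) * g)"
    using circle_assoc[of f e g] circle_add_right[of f 0 "e \<star> g"]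
      circle_add_left[of 0 "f \<star> e" g] by simp
  then have "f - g = (f \<star> e - (f \<star> e) * g) - (e \<star> g - f * (e \<star> g))"
    by (simp add: algebra_simps)
  then have fg: "f - g \<in> I"
    using Id(3)[OF Id(3)[OF f Id(6)[OF f]] Id(3)[OF g Id(5)[OF g]]] by simp
  have "e \<star> f = e \<star> g + ((f - g) - e * (f - g))"
    using circle_add_right[of e g "f - g"] by simp
  then show ?thesis
    using Id(2)[OF g Id(3)[OF fg Id(5)[OF fg]]] by simp
qed

lemma quasi_invertible_two_sided:
  assumes "two_sided_ideal I" and "quasi_invertible I e"
  obtains d where "d \<star> e \<in> I" and "e \<star> d \<in> I"
  using assms left_quasi_inverse_is_right unfolding quasi_invertible_def by blast

lemma quasi_invertible_mono:
  "quasi_invertible I e \<Longrightarrow> I \<subseteq> J \<Longrightarrow> quasi_invertible J e"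
  unfolding quasi_invertible_def by blast

text \<open>These replace the Neumann series: \<open>w \<star> u = 0\<close> says that \<open>w\<close> is a fixed point of
  \<open>w \<mapsto> w u - u\<close>, which contracts with factor \<open>\<parallel>u\<parallel>\<close>.\<close>

lemma small_has_left_quasi_inverse:
  fixes u :: "'a::complex_banach_algebra"
  assumes "norm u < 1"
  shows "\<exists>w. w \<star> u = 0"
proof -
  have "\<forall>v w. dist (v * u - u) (w * u - u) \<le> norm u * dist v w"
    by (simp add: dist_norm flip: left_diff_distrib) (metis mult.commute norm_mult_ineq)
  from banach_fix_type[OF norm_ge_zero assms this]
  obtain w where "w * u - u = w" by blast
  then have "w \<star> u = 0"
    by (simp add: circle_def algebra_simps)
  then show ?thesis ..
qed

lemma small_has_right_quasi_inverse:
  fixes u :: "'a::complex_banach_algebra"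
  assumes "norm u < 1"
  shows "\<exists>w. u \<star> w = 0"
proof -
  have "\<forall>v w. dist (u * v - u) (u * w - u) \<le> norm u * dist v w"
    by (simp add: dist_norm norm_mult_ineq flip: right_diff_distrib)
  from banach_fix_type[OF norm_ge_zero assms this]
  obtain w where "u * w - u = w" by blast
  then have "u \<star> w = 0"
    by (simp add: circle_def algebra_simps)
  then show ?thesis ..
qed

text \<open>An approximate inverse modulo \<open>I\<close> can be corrected to an inverse modulo \<open>I\<close>. This is how
  invertibility at one point of \<open>X\<close> spreads to neighbouring points.\<close>

lemma quasi_invertible_if_nearly:
  assumes I: "two_sided_ideal I"
    and j: "j \<in> I" "norm (d \<star> e - j) < 1" and k: "k \<in> I" "norm (e \<star> d - k) < 1"
  shows "quasi_invertible I e"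
  unfolding quasi_invertible_def
proof
  note Id = two_sided_idealD[OF I]
  obtain w where w: "w \<star> (d \<star> e - j) = 0"
    using small_has_left_quasi_inverse[OF j(2)] by blast
  have "(w \<star> d) \<star> e = j - w * j"
    using circle_add_right[of w "d \<star> e - j" j] w by (simp add: circle_assoc)
  then show "\<exists>d. d \<star> e \<in> I"
    using j(1) Id by metis
  obtain v where v: "(e \<star> d - k) \<star> v = 0"
    using small_has_right_quasi_inverse[OF k(2)] by blast
  have "e \<star> (d \<star> v) = k - k * v"
    using circle_add_left[of "e \<star> d - k" k v] v by (simp add: circle_assoc)
  then show "\<exists>d. e \<star> d \<in> I"
    using k(1) Id by metis
qed

corollary quasi_invertible_if_near_ideal:
  assumes "two_sided_ideal I" and "j \<in> I" and "norm (e - j) < 1"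
  shows "quasi_invertible I e"
  using quasi_invertible_if_nearly[of I j 0 e j] assms by simp


section \<open>The spectrum in a quotient\<close>

lemma coset_eq_iff:
  assumes "two_sided_ideal I"
  shows "coset I a = coset I b \<longleftrightarrow> a - b \<in> I"
proof
  note Id = two_sided_idealD[OF assms]
  show "a - b \<in> I" if "coset I a = coset I b"
  proof -
    have "a \<in> coset I a" using Id(1) by (force simp: coset_def)
    then show ?thesis using that by (auto simp: coset_def)
  qed
  have subset: "coset I a \<subseteq> coset I b" if "a - b \<in> I" for a b
  proof
    fix s assume "s \<in> coset I a"
    then obtain j where "j \<in> I" "s = a + j" by (auto simp: coset_def)
    then have "s = b + ((a - b) + j)" "(a - b) + j \<in> I"
      using Id(2)[OF that] by simp_all
    then show "s \<in> coset I b" unfolding coset_def by blast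
  qed
  show "coset I a = coset I b" if "a - b \<in> I"
    using subset[OF that] subset[of b a] Id(3)[OF Id(1) that] by simp
qed

lemma mem_cosetE:
  assumes "s \<in> coset I a"
  obtains j where "j \<in> I" "s = a + j"
  using assms by (auto simp: coset_def)

lemma quotient_alg_simps:
  assumes I: "two_sided_ideal I"
  shows "alg_add (quotient_alg I) (coset I a) (coset I b) = coset I (a + b)"
    and "alg_mult (quotient_alg I) (coset I a) (coset I b) = coset I (a * b)"
    and "alg_scale (quotient_alg I) c (coset I a) = coset I (c *\<^sub>C a)"
    and "alg_zero (quotient_alg I) = coset I 0"
    and "carrier (quotient_alg I) = range (coset I)"
proof -
  note Id = two_sided_idealD[OF I]
  have add: "coset I (s + t) = coset I (a + b)"
    and mult: "coset I (s * t) = coset I (a * b)"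
    if "s \<in> coset I a" "t \<in> coset I b" for s t
  proof -
    from that obtain j k where j: "j \<in> I" "s = a + j" and k: "k \<in> I" "t = b + k"
      by (meson mem_cosetE)
    have "(s + t) - (a + b) = j + k" "s * t - a * b = a * k + (j * b + j * k)"
      by (simp_all add: j k algebra_simps)
    then show "coset I (s + t) = coset I (a + b)" "coset I (s * t) = coset I (a * b)"
      unfolding coset_eq_iff[OF I] by (simp_all add: Id j(1) k(1))
  qed
  have scale: "coset I (c *\<^sub>C s) = coset I (c *\<^sub>C a)" if "s \<in> coset I a" for s
    using that Id(4) by (auto elim!: mem_cosetE simp: coset_eq_iff[OF I] scaleC_add_right)
  have nonempty: "coset I a \<noteq> {}" for a
    using Id(1) by (auto simp: coset_def)
  show "alg_add (quotient_alg I) (coset I a) (coset I b) = coset I (a + b)"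
    unfolding quotient_alg_def normed_alg.select_convs
    by (rule SUP_eq_const[OF nonempty], rule SUP_eq_const[OF nonempty], rule add)
  show "alg_mult (quotient_alg I) (coset I a) (coset I b) = coset I (a * b)"
    unfolding quotient_alg_def normed_alg.select_convs
    by (rule SUP_eq_const[OF nonempty], rule SUP_eq_const[OF nonempty], rule mult)
  show "alg_scale (quotient_alg I) c (coset I a) = coset I (c *\<^sub>C a)"
    unfolding quotient_alg_def normed_alg.select_convs
    by (rule SUP_eq_const[OF nonempty], rule scale)
  show "alg_zero (quotient_alg I) = coset I 0"
    by (simp add: quotient_alg_def coset_def)
  show "carrier (quotient_alg I) = range (coset I)"
    by (simp add: quotient_alg_def)
qed

lemma unitization_Units_iff:
  "(x, c) \<in> Units (unitization A) \<longleftrightarrow> x \<in> carrier A \<and>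
     (\<exists>y\<in>carrier A. \<exists>d. c * d = 1 \<and>
        alg_add A (alg_mult A x y) (alg_add A (alg_scale A d x) (alg_scale A c y)) = alg_zero A \<and>
        alg_add A (alg_mult A y x) (alg_add A (alg_scale A c y) (alg_scale A d x)) = alg_zero A)"
  by (auto simp: Units_def unitization_def mult.commute)

lemma zero_mem_spectrum: "0 \<in> spectrum A a"
  by (simp add: spectrum_def unitization_Units_iff)

text \<open>For \<open>c \<noteq> 0\<close> the inverse of \<open>c - a = c(1 - a/c)\<close> is \<open>(1 - d)/c\<close>, where \<open>d\<close> is the
  quasi-inverse of \<open>a/c\<close>.\<close>

lemma unit_equation_iff_circle:
  fixes a b :: "'a::complex_banach_algebra"
  assumes "c \<noteq> 0"
  shows "((-1) *\<^sub>C a) * b + ((1/c) *\<^sub>C (-1) *\<^sub>C a + c *\<^sub>C b)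
           = - ((1/c) *\<^sub>C a \<star> (- c) *\<^sub>C b)"
    and "b * ((-1) *\<^sub>C a) + (c *\<^sub>C b + (1/c) *\<^sub>C (-1) *\<^sub>C a)
           = - ((- c) *\<^sub>C b \<star> (1/c) *\<^sub>C a)"
  using assms
  by (simp_all add: circle_def mult_scaleC_left mult_scaleC_right scaleC_scaleC)

lemma spectrum_quotient_alg:
  assumes I: "two_sided_ideal I" and c: "c \<noteq> 0"
  shows "c \<in> spectrum (quotient_alg I) (coset I a) \<longleftrightarrow> \<not> quasi_invertible I ((1/c) *\<^sub>C a)"
proof -
  note Id = two_sided_idealD[OF I]
  let ?e = "(1/c) *\<^sub>C a"
  have neg: "- s \<in> I \<longleftrightarrow> s \<in> I" for s
    using Id(3)[OF Id(1), of s] Id(3)[OF Id(1), of "- s"] by auto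
  have d: "c * d = 1 \<longleftrightarrow> d = 1/c" for d
    using c by (auto simp: field_simps)
  have "(alg_scale (quotient_alg I) (-1) (coset I a), c) \<in> Units (unitization (quotient_alg I))
    \<longleftrightarrow> (\<exists>b. ((-1) *\<^sub>C a) * b + ((1/c) *\<^sub>C (-1) *\<^sub>C a + c *\<^sub>C b) \<in> I \<and>
             b * ((-1) *\<^sub>C a) + (c *\<^sub>C b + (1/c) *\<^sub>C (-1) *\<^sub>C a) \<in> I)"
    unfolding unitization_Units_iff quotient_alg_simps[OF I] d coset_eq_iff[OF I] bex_simps
    by (simp only: quotient_alg_simps[OF I] coset_eq_iff[OF I] diff_0_right rangeI
        simp_thms ex_simps)
  also have "\<dots> \<longleftrightarrow> (\<exists>b. ?e \<star> (- c) *\<^sub>C b \<in> I \<and> (- c) *\<^sub>C b \<star> ?e \<in> I)"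
    unfolding unit_equation_iff_circle[OF c] neg ..
  also have "\<dots> \<longleftrightarrow> (\<exists>d. ?e \<star> d \<in> I \<and> d \<star> ?e \<in> I)" (is "?L \<longleftrightarrow> ?R")
  proof
    show ?R if ?L using that by blast
    show ?L if ?R
    proof -
      from that obtain d where "?e \<star> d \<in> I" "d \<star> ?e \<in> I" by blast
      moreover have "(- c) *\<^sub>C ((- 1/c) *\<^sub>C d) = d"
        using c by (simp add: scaleC_scaleC)
      ultimately show ?L by (intro exI[of _ "(- 1/c) *\<^sub>C d"]) simp
    qed
  qed
  also have "\<dots> \<longleftrightarrow> quasi_invertible I ?e"
    using quasi_invertible_two_sided[OF I] unfolding quasi_invertible_def by metis
  finally show ?thesis by (simp add: spectrum_def)
qed

text \<open>The algebra itself is its quotient by the zero ideal, with singletons as cosets.\<close>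

lemma spectrum_type_alg: "spectrum type_alg a = spectrum (quotient_alg {0}) (coset {0} a)"
proof -
  have coset: "coset {0} b = {b}" for b :: 'a
    by (simp add: coset_def)
  have "((-1) *\<^sub>C a, c) \<in> Units (unitization type_alg) \<longleftrightarrow>
      ({(-1) *\<^sub>C a}, c) \<in> Units (unitization (quotient_alg {0}))" for c
    unfolding unitization_Units_iff by (simp add: type_alg_def quotient_alg_def coset)
  then show ?thesis
    by (simp add: spectrum_def coset quotient_alg_def type_alg_def)
qed

lemma spectrum_le_if_near_ideal:
  assumes I: "two_sided_ideal I" and j: "j \<in> I" and c: "c \<in> spectrum (quotient_alg I) (coset I a)"
  shows "cmod c \<le> norm (a - j)"
proof (rule ccontr)
  assume less: "\<not> cmod c \<le> norm (a - j)"
  then have "c \<noteq> 0" by auto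
  have "(1/c) *\<^sub>C a - (1/c) *\<^sub>C j = (1/c) *\<^sub>C (a - j)"
    by (simp add: complex_vector.scale_right_diff_distrib)
  then have "norm ((1/c) *\<^sub>C a - (1/c) *\<^sub>C j) < 1"
    using less \<open>c \<noteq> 0\<close> by (simp add: norm_scaleC norm_divide)
  then have "quasi_invertible I ((1/c) *\<^sub>C a)"
    using quasi_invertible_if_near_ideal[OF I two_sided_idealD(4)[OF I j]] by blast
  then show False
    using c spectrum_quotient_alg[OF I \<open>c \<noteq> 0\<close>] by blast
qed

lemma bdd_above_spectrum:
  assumes I: "two_sided_ideal I"
  shows "bdd_above (cmod ` spectrum (quotient_alg I) (coset I a))"
  using spectrum_le_if_near_ideal[OF I two_sided_idealD(1)[OF I]] by (rule bdd_aboveI2)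

lemma spectral_radius_le_if_near_ideal:
  assumes "two_sided_ideal I" and "j \<in> I"
  shows "spectral_radius (quotient_alg I) (coset I a) \<le> norm (a - j)"
  unfolding spectral_radius_def
proof (rule cSUP_least)
  show "spectrum (quotient_alg I) (coset I a) \<noteq> {}"
    using zero_mem_spectrum[of "quotient_alg I" "coset I a"] by blast
qed (rule spectrum_le_if_near_ideal[OF assms])

lemma le_spectral_radius:
  assumes "two_sided_ideal I" and "c \<in> spectrum (quotient_alg I) (coset I a)"
  shows "cmod c \<le> spectral_radius (quotient_alg I) (coset I a)"
  unfolding spectral_radius_def by (rule cSUP_upper[OF assms(2) bdd_above_spectrum[OF assms(1)]])

lemma spectral_radius_nonneg:
  "two_sided_ideal I \<Longrightarrow> 0 \<le> spectral_radius (quotient_alg I) (coset I a)"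
  using le_spectral_radius[OF _ zero_mem_spectrum, of I a] by simp


section \<open>Closed ideals of \<open>C\<^sub>0(X)\<close>\<close>

lemma C0_if_zero_off_compact:
  assumes "continuous_on UNIV f" and "compact K" and "\<And>x. x \<notin> K \<Longrightarrow> f x = 0"
  shows "f \<in> C0"
  using assms unfolding C0_def vanishes_at_infinity_def by auto

lemma C0_smallE:
  assumes "f \<in> C0" and "e > 0"
  obtains K where "compact K" and "\<And>x. x \<notin> K \<Longrightarrow> cmod (f x) < e"
  using assms unfolding C0_def vanishes_at_infinity_def by blast

lemma C0_continuous: "f \<in> C0 \<Longrightarrow> continuous_on UNIV f"
  by (simp add: C0_def)

lemma C0_zero: "(\<lambda>_. 0) \<in> C0"
  by (rule C0_if_zero_off_compact[of _ "{}"]) auto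

lemma C0_cnj: "f \<in> C0 \<Longrightarrow> (\<lambda>x. cnj (f x)) \<in> C0"
  by (simp add: C0_def vanishes_at_infinity_def continuous_on_cnj)

lemma C0_add:
  assumes "f \<in> C0" and "g \<in> C0"
  shows "(\<lambda>x. f x + g x) \<in> C0"
proof -
  have "\<exists>K. compact K \<and> (\<forall>x. x \<notin> K \<longrightarrow> cmod (f x + g x) < e)" if "e > 0" for e
  proof -
    obtain K where K: "compact K" "\<And>x. x \<notin> K \<Longrightarrow> cmod (f x) < e/2"
      using C0_smallE[OF assms(1) half_gt_zero[OF \<open>e > 0\<close>]] by blast
    obtain L where L: "compact L" "\<And>x. x \<notin> L \<Longrightarrow> cmod (g x) < e/2"
      using C0_smallE[OF assms(2) half_gt_zero[OF \<open>e > 0\<close>]] by blast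
    have "cmod (f x + g x) < e" if "x \<notin> K \<union> L" for x
      using that K(2)[of x] L(2)[of x] norm_triangle_ineq[of "f x" "g x"] by simp
    then show ?thesis
      using compact_Un[OF K(1) L(1)] by blast
  qed
  then show ?thesis
    using assms by (simp add: C0_def vanishes_at_infinity_def continuous_on_add)
qed

lemma C0_mult:
  assumes "f \<in> C0" and "g \<in> C0"
  shows "(\<lambda>x. f x * g x) \<in> C0"
proof -
  have "\<exists>K. compact K \<and> (\<forall>x. x \<notin> K \<longrightarrow> cmod (f x * g x) < e)" if "e > 0" for e
  proof -
    obtain K where K: "compact K" "\<And>x. x \<notin> K \<Longrightarrow> cmod (f x) < e"
      using C0_smallE[OF assms(1) \<open>e > 0\<close>] by blast
    obtain L where L: "compact L" "\<And>x. x \<notin> L \<Longrightarrow> cmod (g x) < 1"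
      using C0_smallE[OF assms(2) zero_less_one] by blast
    have "cmod (f x * g x) < e" if "x \<notin> K \<union> L" for x
      using that K(2)[of x] L(2)[of x]
        mult_strict_mono'[of "cmod (f x)" e "cmod (g x)" 1] by (simp add: norm_mult)
    then show ?thesis
      using compact_Un[OF K(1) L(1)] by blast
  qed
  then show ?thesis
    using assms by (simp add: C0_def vanishes_at_infinity_def continuous_on_mult)
qed

lemma C0_scale:
  assumes "f \<in> C0"
  shows "(\<lambda>x. c * f x) \<in> C0"
proof -
  have "\<exists>K. compact K \<and> (\<forall>x. x \<notin> K \<longrightarrow> cmod (c * f x) < e)" if "e > 0" for e
  proof -
    have pos: "e / (1 + cmod c) > 0"
      using \<open>e > 0\<close> by (simp add: add_pos_nonneg)
    obtain K where K: "compact K" "\<And>x. x \<notin> K \<Longrightarrow> cmod (f x) < e / (1 + cmod c)"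
      using C0_smallE[OF assms pos] by blast
    have "cmod (c * f x) < e" if "x \<notin> K" for x
    proof -
      have "cmod (c * f x) \<le> (1 + cmod c) * cmod (f x)"
        by (simp add: norm_mult distrib_right)
      also have "\<dots> < e"
        using K(2)[OF that] by (simp add: pos_less_divide_eq add_pos_nonneg mult.commute)
      finally show ?thesis .
    qed
    then show ?thesis using K(1) by blast
  qed
  then show ?thesis
    using assms by (simp add: C0_def vanishes_at_infinity_def continuous_on_mult_left)
qed

lemma C0_diff: "f \<in> C0 \<Longrightarrow> g \<in> C0 \<Longrightarrow> (\<lambda>x. f x - g x) \<in> C0"
  using C0_add[OF _ C0_scale[of g "-1"], of f] by simp

text \<open>Soft thresholding moves a number by at most \<open>e\<close> towards \<open>0\<close>. Applied to a function
  in \<open>C\<^sub>0(X)\<close> it gives a uniformly close function of compact support, and if the function is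
  zero at a point, the result is zero on a neighbourhood of that point.\<close>

definition soft_threshold :: "real \<Rightarrow> complex \<Rightarrow> complex" where
  "soft_threshold e z = z * of_real (1 - e / max e (cmod z))"

lemma soft_threshold_eq_0_iff: "e > 0 \<Longrightarrow> soft_threshold e z = 0 \<longleftrightarrow> cmod z \<le> e"
  by (auto simp: soft_threshold_def max_def)

lemma soft_threshold_dist: "e > 0 \<Longrightarrow> cmod (z - soft_threshold e z) \<le> e"
proof -
  assume "e > 0"
  have "z - soft_threshold e z = of_real (e / max e (cmod z)) * z"
    by (simp add: soft_threshold_def algebra_simps)
  then have "cmod (z - soft_threshold e z) = e / max e (cmod z) * cmod z"
    using \<open>e > 0\<close> by (simp add: norm_mult norm_divide max_def)
  also have "\<dots> \<le> e"
    using \<open>e > 0\<close> by (simp add: max_def)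
  finally show ?thesis .
qed

lemma continuous_on_soft_threshold:
  assumes "e > 0" and "continuous_on S f"
  shows "continuous_on S (\<lambda>x. soft_threshold e (f x))"
  unfolding soft_threshold_def using assms by (auto intro!: continuous_intros)

lemma C0_soft_threshold:
  assumes "e > 0" and "f \<in> C0"
  shows "(\<lambda>x. soft_threshold e (f x)) \<in> C0"
proof -
  obtain K where "compact K" and K: "\<And>x. x \<notin> K \<Longrightarrow> cmod (f x) < e"
    using C0_smallE[OF assms(2,1)] by blast
  show ?thesis
    using continuous_on_soft_threshold[OF assms(1) C0_continuous[OF assms(2)]] \<open>compact K\<close>
  proof (rule C0_if_zero_off_compact)
    show "soft_threshold e (f x) = 0" if "x \<notin> K" for x
      using K[OF that] soft_threshold_eq_0_iff[OF assms(1)] by simp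
  qed
qed

lemma sup_norm_le: "(\<And>x. cmod (f x) \<le> e) \<Longrightarrow> sup_norm f \<le> e"
  unfolding sup_norm_def by (rule cSUP_least) auto

lemma locally_compact_C0_bump:
  fixes x :: "'x::t2_space"
  assumes lc: "locally_compact_space (euclidean :: 'x topology)" and U: "open U" "x \<in> U"
  obtains g where "g \<in> C0" and "g x = 1" and "\<And>y. y \<notin> U \<Longrightarrow> g y = 0"
proof -
  obtain V K where V: "open V" "compact K" "x \<in> V" "V \<subseteq> K"
    using lc unfolding locally_compact_space_def by simp metis
  have "completely_regular_space (euclidean :: 'x topology)"
    using locally_compact_regular_imp_completely_regular_space[OF lc] hausdorff
    by (auto simp: Hausdorff_space_def disjnt_def)
  moreover have "closedin euclidean (- (U \<inter> V))" "x \<in> topspace euclidean - (- (U \<inter> V))"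
    using U V by (auto intro: closed_Compl open_Int)
  ultimately obtain f :: "'x \<Rightarrow> real" where
    f: "continuous_map euclidean (top_of_set {0..1}) f" "f x = 0" "f ` (- (U \<inter> V)) \<subseteq> {1}"
    unfolding completely_regular_space_def by blast
  have "continuous_on UNIV f"
    using f(1) by (simp add: continuous_map_in_subtopology)
  then have "continuous_on UNIV (\<lambda>y. complex_of_real (1 - f y))"
    by (intro continuous_intros)
  moreover have zero: "complex_of_real (1 - f y) = 0" if "y \<notin> U \<inter> V" for y
    using f(3) that by auto
  ultimately have "(\<lambda>y. complex_of_real (1 - f y)) \<in> C0"
    using V by (intro C0_if_zero_off_compact[of _ K]) auto
  then show thesis
    using that[of "\<lambda>y. complex_of_real (1 - f y)"] f(2) zero by simp
qed

text \<open>This is the familiar fact that a proper closed ideal \<open>J\<close> of \<open>C\<^sub>0(X)\<close> has a common zero,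
  with closedness in the form in which it is verified later: \<open>f \<in> J\<close> as soon as all soft
  thresholdings of \<open>f\<close> are in \<open>J\<close>. If there is no common zero and \<open>K\<close> is compact, finitely
  many \<open>g \<in> J\<close> have no common zero on \<open>K\<close>, and \<open>F = \<Sum> \<bar>g\<bar>\<^sup>2 \<in> J\<close> is
  positive there. A function that is zero off \<open>K\<close> is therefore a multiple of \<open>F\<close>, so
  all soft thresholdings of functions in \<open>C\<^sub>0(X)\<close> belong to \<open>J\<close>.\<close>

lemma C0_ideal_common_zero:
  fixes J :: "('x::t2_space \<Rightarrow> complex) set"
  assumes sub: "J \<subseteq> C0" and zero: "(\<lambda>_. 0) \<in> J"
    and add: "\<And>f g. f \<in> J \<Longrightarrow> g \<in> J \<Longrightarrow> (\<lambda>x. f x + g x) \<in> J"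
    and mult: "\<And>f g. f \<in> C0 \<Longrightarrow> g \<in> J \<Longrightarrow> (\<lambda>x. f x * g x) \<in> J"
    and limit: "\<And>f. f \<in> C0 \<Longrightarrow> (\<And>e. e > 0 \<Longrightarrow> (\<lambda>x. soft_threshold e (f x)) \<in> J) \<Longrightarrow> f \<in> J"
    and proper: "J \<noteq> C0"
  obtains x where "\<And>f. f \<in> J \<Longrightarrow> f x = 0"
proof (rule ccontr)
  assume "\<not> thesis"
  then have nz: "\<exists>g\<in>J. g x \<noteq> 0" for x
    using that by blast
  have "(\<lambda>x. soft_threshold e (f x)) \<in> J" if f: "f \<in> C0" and e: "e > 0" for f e
  proof -
    let ?t = "\<lambda>x. soft_threshold e (f x)"
    obtain K where K: "compact K" "\<And>x. x \<notin> K \<Longrightarrow> cmod (f x) < e"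
      using C0_smallE[OF f e] by blast
    have K0: "closed {x. e \<le> cmod (f x)}"
      using C0_continuous[OF f] by (intro closed_Collect_le continuous_intros)
    have "{x. e \<le> cmod (f x)} \<subseteq> K"
      using K(2) by (force simp: not_less[symmetric])
    with K(1) K0 have cpt: "compact {x. e \<le> cmod (f x)}"
      by (metis compact_Int_closed inf.absorb_iff2)
    have "open {x. g x \<noteq> 0}" if "g \<in> J" for g
      using that sub C0_continuous by (intro open_Collect_neq continuous_on_const) blast
    moreover have "{x. e \<le> cmod (f x)} \<subseteq> (\<Union>g\<in>J. {x. g x \<noteq> 0})"
      using nz by blast
    ultimately obtain G where
      G: "G \<subseteq> J" "finite G" "{x. e \<le> cmod (f x)} \<subseteq> (\<Union>g\<in>G. {x. g x \<noteq> 0})"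
      by (rule compactE_image[OF cpt])
    define F where "F = (\<lambda>x. \<Sum>g\<in>G. cnj (g x) * g x)"
    have FJ: "F \<in> J"
      using G(2,1) unfolding F_def
    proof (induction G)
      case (insert g H)
      then have "(\<lambda>x. cnj (g x) * g x) \<in> J"
        using sub by (intro mult C0_cnj) auto
      then show ?case using insert add by simp
    qed (simp add: zero)
    have Fnz: "F x \<noteq> 0" if "e \<le> cmod (f x)" for x
    proof -
      from that G(3) obtain g where g: "g \<in> G" "g x \<noteq> 0" by blast
      have "F x = of_real (\<Sum>g\<in>G. (cmod (g x))\<^sup>2)"
        by (simp only: F_def of_real_sum complex_norm_square mult.commute)
      moreover have "(\<Sum>g\<in>G. (cmod (g x))\<^sup>2) > 0"
        using g G(2) by (intro sum_pos2[of _ g]) auto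
      ultimately show ?thesis by (metis less_irrefl of_real_eq_0_iff)
    qed
    have t0: "?t x = 0" if "\<not> e \<le> cmod (f x)" for x
      using that soft_threshold_eq_0_iff[OF e] by simp
    let ?h = "\<lambda>x. ?t x / F x"
    have contF: "continuous_on UNIV F"
      using FJ sub C0_continuous by blast
    have contt: "continuous_on UNIV ?t"
      by (rule continuous_on_soft_threshold[OF e C0_continuous[OF f]])
    have "continuous_on {x. F x \<noteq> 0} ?h"
      using contF contt by (intro continuous_on_divide) (auto intro: continuous_on_subset)
    moreover have "continuous_on {x. \<not> e \<le> cmod (f x)} ?h"
      using t0 by (intro continuous_on_eq[OF continuous_on_const[of _ 0]]) auto
    moreover have "open {x. F x \<noteq> 0}"
      using contF by (intro open_Collect_neq continuous_on_const)
    moreover have "open {x. \<not> e \<le> cmod (f x)}"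
      using K0 by (simp add: closed_def Collect_neg_eq)
    ultimately have "continuous_on ({x. F x \<noteq> 0} \<union> {x. \<not> e \<le> cmod (f x)}) ?h"
      by (rule continuous_on_open_Un[rotated 2])
    moreover have "{x. F x \<noteq> 0} \<union> {x. \<not> e \<le> cmod (f x)} = UNIV"
      using Fnz by auto
    ultimately have "continuous_on UNIV ?h"
      by simp
    then have "?h \<in> C0"
      using cpt by (rule C0_if_zero_off_compact) (use t0 in auto)
    then have "(\<lambda>x. ?h x * F x) \<in> J"
      using FJ by (rule mult)
    moreover have "?h x * F x = ?t x" for x
      using t0[of x] Fnz[of x] by auto
    ultimately show ?thesis by simp
  qed
  then have "J = C0"
    using sub limit by blast
  with proper show False ..
qed


section \<open>Fibre ideals\<close>

lemma bounded_linear_scaleC: "bounded_linear (\<lambda>a :: 'a::complex_banach. c *\<^sub>C a)"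
proof (rule bounded_linear_intro)
  show "c *\<^sub>C (r *\<^sub>R a) = r *\<^sub>R (c *\<^sub>C a)" for r and a :: 'a
    by (simp add: scaleC_scaleC mult.commute flip: scaleC_of_real)
  show "norm (c *\<^sub>C a) \<le> norm a * cmod c" for a :: 'a
    by (simp add: norm_scaleC mult.commute)
qed (rule scaleC_add_right)

lemma subspace_closure_complex:
  fixes S :: "'a::complex_banach set"
  assumes "complex_vector.subspace S"
  shows "complex_vector.subspace (closure S)"
proof -
  note S = assms[unfolded complex_vector.subspace_def]
  have "0 \<in> closure S"
    using S closure_subset by blast
  moreover have "a + b \<in> closure S" if ab: "a \<in> closure S" "b \<in> closure S" for a b
  proof -
    from ab obtain u v where "\<forall>n. u n \<in> S" "u \<longlonglongrightarrow> a" "\<forall>n. v n \<in> S" "v \<longlonglongrightarrow> b"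
      unfolding closure_sequential by blast
    then have "\<forall>n. u n + v n \<in> S" "(\<lambda>n. u n + v n) \<longlonglongrightarrow> a + b"
      using S by (simp_all add: tendsto_add)
    then show ?thesis
      unfolding closure_sequential by (intro exI[of _ "\<lambda>n. u n + v n"]) simp
  qed
  moreover have "c *\<^sub>C a \<in> closure S" if a: "a \<in> closure S" for c a
  proof -
    from a obtain u where "\<forall>n. u n \<in> S" "u \<longlonglongrightarrow> a"
      unfolding closure_sequential by blast
    then have "\<forall>n. c *\<^sub>C u n \<in> S" "(\<lambda>n. c *\<^sub>C u n) \<longlonglongrightarrow> c *\<^sub>C a"
      using S bounded_linear.tendsto[OF bounded_linear_scaleC] by blast+
    then show ?thesis
      unfolding closure_sequential by (intro exI[of _ "\<lambda>n. c *\<^sub>C u n"]) simp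
  qed
  ultimately show ?thesis
    by (simp add: complex_vector.subspace_def)
qed

lemma closure_span_subset:
  assumes "closed S" and "complex_vector.subspace S" and "B \<subseteq> S"
  shows "closure (complex_vector.span B) \<subseteq> S"
  using assms complex_vector.span_minimal closure_minimal by metis

context C0_banach_space
begin

lemma act_diff_left:
  assumes "f \<in> C0" and "g \<in> C0"
  shows "act (\<lambda>x. f x - g x) a = act f a - act g a"
proof -
  have "act (\<lambda>x. f x - g x) a = act (\<lambda>x. f x + (-1) * g x) a" by simp
  also have "\<dots> = act f a + (-1) *\<^sub>C act g a"
    using assms C0_scale[of g "-1"] by (simp only: act_add_left act_scale_left)
  finally show ?thesis by simp
qed

text \<open>Since \<open>f\<close> is uniformly within \<open>e\<close> of its soft thresholding and the module structure is
  contractive, \<open>f a\<close> is a limit of elements given by functions that are easier to handle.\<close>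

lemma act_mem_closed:
  assumes S: "closed S" and f: "f \<in> C0"
    and mem: "\<And>e. e > 0 \<Longrightarrow> act (\<lambda>x. soft_threshold e (f x)) a \<in> S"
  shows "act f a \<in> S"
  unfolding closed_approachable[OF S, symmetric]
proof (intro allI impI)
  fix r :: real assume "r > 0"
  define e where "e = r / (1 + norm a)"
  have "e > 0"
    using \<open>r > 0\<close> by (simp add: e_def add_pos_nonneg)
  let ?t = "\<lambda>x. soft_threshold e (f x)"
  have "norm (act f a - act ?t a) \<le> sup_norm (\<lambda>x. f x - ?t x) * norm a"
    using act_contractive[OF C0_diff[OF f C0_soft_threshold[OF \<open>e > 0\<close> f]]]
    by (simp add: act_diff_left f C0_soft_threshold \<open>e > 0\<close>)
  also have "\<dots> \<le> e * norm a"
    using \<open>e > 0\<close> by (intro mult_right_mono sup_norm_le soft_threshold_dist) auto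
  also have "\<dots> < e * (1 + norm a)"
    using \<open>e > 0\<close> by simp
  also have "\<dots> = r"
    by (simp add: e_def add_pos_nonneg less_imp_neq[symmetric])
  finally have "dist (act ?t a) (act f a) < r"
    by (simp add: dist_norm norm_minus_commute)
  then show "\<exists>s\<in>S. dist s (act f a) < r"
    using mem[OF \<open>e > 0\<close>] by blast
qed

end

context C0_banach_algebra
begin

lemma closed_fibre_ideal: "closed (fibre_ideal act x)"
  by (simp add: fibre_ideal_def)

lemma subspace_fibre_ideal: "complex_vector.subspace (fibre_ideal act x)"
  unfolding fibre_ideal_def by (intro subspace_closure_complex complex_vector.subspace_span)

lemma act_mem_fibre_ideal: "f \<in> C0 \<Longrightarrow> f x = 0 \<Longrightarrow> act f a \<in> fibre_ideal act x"
  unfolding fibre_ideal_def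
  by (intro subsetD[OF closure_subset] complex_vector.span_base) blast

lemma fibre_ideal_subset:
  assumes "closed S" and "complex_vector.subspace S"
    and "\<And>f a. f \<in> C0 \<Longrightarrow> f x = 0 \<Longrightarrow> act f a \<in> S"
  shows "fibre_ideal act x \<subseteq> S"
  unfolding fibre_ideal_def using assms by (intro closure_span_subset) auto

lemma two_sided_ideal_fibre_ideal: "two_sided_ideal (fibre_ideal act x)"
proof -
  let ?I = "fibre_ideal act x"
  note sub = subspace_fibre_ideal[of x, unfolded complex_vector.subspace_def]
  have "?I \<subseteq> {s. b * s \<in> ?I}" for b
  proof (rule fibre_ideal_subset)
    show "closed {s. b * s \<in> ?I}"
      using closed_vimage[OF closed_fibre_ideal[of x], of "\<lambda>s. b * s"]
      by (simp add: vimage_def continuous_intros)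
    show "complex_vector.subspace {s. b * s \<in> ?I}"
      using sub by (simp add: complex_vector.subspace_def distrib_left mult_scaleC_right)
    show "act f a \<in> {s. b * s \<in> ?I}" if "f \<in> C0" "f x = 0" for f a
      using act_mem_fibre_ideal[of f x "b * a"] act_mult_right[of f b a] that by simp
  qed
  moreover have "?I \<subseteq> {s. s * b \<in> ?I}" for b
  proof (rule fibre_ideal_subset)
    show "closed {s. s * b \<in> ?I}"
      using closed_vimage[OF closed_fibre_ideal[of x], of "\<lambda>s. s * b"]
      by (simp add: vimage_def continuous_intros)
    show "complex_vector.subspace {s. s * b \<in> ?I}"
      using sub by (simp add: complex_vector.subspace_def distrib_right mult_scaleC_left)
    show "act f a \<in> {s. s * b \<in> ?I}" if "f \<in> C0" "f x = 0" for f a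
      using act_mem_fibre_ideal[of f x "a * b"] act_mult_left[of f a b] that by simp
  qed
  ultimately show ?thesis
    using subspace_fibre_ideal by (auto simp: two_sided_ideal_def)
qed

text \<open>The norm of the fibre is upper semicontinuous in the point. On the level of ideals:
  the elements that lie in the fibre ideals of all points near \<open>x\<close> are dense in the fibre ideal
  of \<open>x\<close>, because soft thresholding turns a function that is zero at \<open>x\<close> into one that is zero
  near \<open>x\<close>.\<close>

lemma fibre_ideal_approx_nearby:
  assumes "j \<in> fibre_ideal act x" and "e > 0"
  obtains s U where "norm (j - s) < e" and "open U" and "x \<in> U"
    and "\<And>y. y \<in> U \<Longrightarrow> s \<in> fibre_ideal act y"
proof -
  define D where "D = {s. \<exists>U. open U \<and> x \<in> U \<and> (\<forall>y\<in>U. s \<in> fibre_ideal act y)}"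
  note sub = subspace_fibre_ideal[unfolded complex_vector.subspace_def]
  have "0 \<in> D"
    using sub by (auto simp: D_def)
  moreover have "s + t \<in> D" if "s \<in> D" "t \<in> D" for s t
  proof -
    from that obtain U V where "open U" "x \<in> U" "\<forall>y\<in>U. s \<in> fibre_ideal act y"
      and "open V" "x \<in> V" "\<forall>y\<in>V. t \<in> fibre_ideal act y"
      unfolding D_def by blast
    then show ?thesis
      unfolding D_def using sub by (intro CollectI exI[of _ "U \<inter> V"]) auto
  qed
  moreover have "c *\<^sub>C s \<in> D" if "s \<in> D" for c s
    using that unfolding D_def by (auto intro: complex_vector.subspace_scale[OF subspace_fibre_ideal])
  ultimately have "complex_vector.subspace D"
    by (simp add: complex_vector.subspace_def)
  then have "fibre_ideal act x \<subseteq> closure D"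
  proof (intro fibre_ideal_subset subspace_closure_complex closed_closure)
    fix f a assume f: "f \<in> C0" "f x = 0"
    show "act f a \<in> closure D"
    proof (rule act_mem_closed[OF closed_closure f(1)])
      fix r :: real assume "r > 0"
      have "open {y. cmod (f y) < r}"
        using C0_continuous[OF f(1)] by (intro open_Collect_less continuous_intros)
      moreover have "act (\<lambda>x. soft_threshold r (f x)) a \<in> fibre_ideal act y"
        if "cmod (f y) < r" for y
        using that \<open>r > 0\<close> f(1)
        by (intro act_mem_fibre_ideal C0_soft_threshold) (simp_all add: soft_threshold_eq_0_iff)
      ultimately have "act (\<lambda>x. soft_threshold r (f x)) a \<in> D"
        unfolding D_def using f(2) \<open>r > 0\<close>
        by (intro CollectI exI[of _ "{y. cmod (f y) < r}"]) simp
      then show "act (\<lambda>x. soft_threshold r (f x)) a \<in> closure D"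
        using closure_subset by blast
    qed
  qed
  with assms(1) have "j \<in> closure D" by blast
  with assms(2) obtain s where "s \<in> D" "dist s j < e"
    unfolding closure_approachable by blast
  then show thesis
    using that unfolding D_def by (auto simp: dist_norm norm_minus_commute)
qed

text \<open>Non-degeneracy means that \<open>A\<close> is topologically spanned by the \<open>f b\<close> with \<open>f \<in> C\<^sub>0(X)\<close>,
  and after soft thresholding \<open>f\<close> has compact support. This makes the norm of the fibre vanish
  at infinity.\<close>

lemma fibre_ideal_approx_at_infinity:
  assumes "e > 0"
  obtains s K where "norm (a - s) < e" and "compact K"
    and "\<And>y. y \<notin> K \<Longrightarrow> s \<in> fibre_ideal act y"
proof -
  define D where "D = {s. \<exists>K. compact K \<and> (\<forall>y. y \<notin> K \<longrightarrow> s \<in> fibre_ideal act y)}"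
  note sub = subspace_fibre_ideal[unfolded complex_vector.subspace_def]
  have "0 \<in> D"
    using sub by (auto simp: D_def)
  moreover have "s + t \<in> D" if "s \<in> D" "t \<in> D" for s t
  proof -
    from that obtain K L where "compact K" "\<forall>y. y \<notin> K \<longrightarrow> s \<in> fibre_ideal act y"
      and "compact L" "\<forall>y. y \<notin> L \<longrightarrow> t \<in> fibre_ideal act y"
      unfolding D_def by blast
    then show ?thesis
      unfolding D_def using sub by (intro CollectI exI[of _ "K \<union> L"]) auto
  qed
  moreover have "c *\<^sub>C s \<in> D" if "s \<in> D" for c s
    using that unfolding D_def by (auto intro: complex_vector.subspace_scale[OF subspace_fibre_ideal])
  ultimately have "complex_vector.subspace D"
    by (simp add: complex_vector.subspace_def)
  moreover have "act f b \<in> closure D" if f: "f \<in> C0" for f b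
  proof (rule act_mem_closed[OF closed_closure f])
    fix r :: real assume "r > 0"
    obtain K where K: "compact K" "\<And>y. y \<notin> K \<Longrightarrow> cmod (f y) < r"
      using C0_smallE[OF f \<open>r > 0\<close>] by blast
    have "act (\<lambda>x. soft_threshold r (f x)) b \<in> fibre_ideal act y" if "y \<notin> K" for y
      using K(2)[OF that] \<open>r > 0\<close> f
      by (intro act_mem_fibre_ideal C0_soft_threshold) (simp_all add: soft_threshold_eq_0_iff)
    then have "act (\<lambda>x. soft_threshold r (f x)) b \<in> D"
      unfolding D_def using K(1) by blast
    then show "act (\<lambda>x. soft_threshold r (f x)) b \<in> closure D"
      using closure_subset by blast
  qed
  ultimately have "closure (complex_vector.span {act f b | f b. f \<in> C0}) \<subseteq> closure D"
    by (intro closure_span_subset subspace_closure_complex) auto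
  then have "a \<in> closure D"
    unfolding act_nondegenerate by blast
  with assms obtain s where "s \<in> D" "dist s a < e"
    unfolding closure_approachable by blast
  then show thesis
    using that unfolding D_def by (auto simp: dist_norm norm_minus_commute)
qed

end


section \<open>Modular maximal left ideals live on a fibre\<close>

text \<open>The last condition says that \<open>e\<close> is a right unit modulo \<open>L\<close>. Such \<open>L\<close> correspond to the
  left ideals of the unitization that contain \<open>1 - e\<close>, and \<open>L\<close> is proper precisely if
  \<open>e \<notin> L\<close>.\<close>

definition modular_left_ideal :: "'a::complex_banach_algebra \<Rightarrow> 'a set \<Rightarrow> bool" where
  "modular_left_ideal e L \<longleftrightarrow> complex_vector.subspace L \<and>
     (\<forall>a. \<forall>l\<in>L. a * l \<in> L) \<and> (\<forall>a. a - a * e \<in> L)"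

definition maximal_modular_left_ideal :: "'a::complex_banach_algebra \<Rightarrow> 'a set \<Rightarrow> bool" where
  "maximal_modular_left_ideal e M \<longleftrightarrow> modular_left_ideal e M \<and> e \<notin> M \<and>
     (\<forall>L. modular_left_ideal e L \<longrightarrow> M \<subseteq> L \<longrightarrow> e \<notin> L \<longrightarrow> L = M)"

lemma modular_left_idealD:
  assumes "modular_left_ideal e L"
  shows "complex_vector.subspace L" and "l \<in> L \<Longrightarrow> a * l \<in> L" and "a - a * e \<in> L"
  using assms by (simp_all add: modular_left_ideal_def)

lemma modular_left_ideal_range: "modular_left_ideal e (range (\<lambda>b. b - b * e))"
proof -
  have "0 = 0 - 0 * e"
    "(b - b * e) + (b' - b' * e) = (b + b') - (b + b') * e"
    "c *\<^sub>C (b - b * e) = c *\<^sub>C b - (c *\<^sub>C b) * e"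
    "a * (b - b * e) = a * b - (a * b) * e" for a b b' c
    by (simp_all add: algebra_simps mult_scaleC_left complex_vector.scale_right_diff_distrib)
  then show ?thesis
    unfolding modular_left_ideal_def complex_vector.subspace_def by blast
qed

lemma modular_left_ideal_Union_chain:
  assumes ne: "C \<noteq> {}" and mod: "\<And>L. L \<in> C \<Longrightarrow> modular_left_ideal e L"
    and chain: "\<And>L L'. L \<in> C \<Longrightarrow> L' \<in> C \<Longrightarrow> L \<subseteq> L' \<or> L' \<subseteq> L"
  shows "modular_left_ideal e (\<Union>C)"
proof -
  note sub = modular_left_idealD(1)[OF mod, unfolded complex_vector.subspace_def]
  have "s + t \<in> \<Union>C" if "s \<in> \<Union>C" "t \<in> \<Union>C" for s t
  proof -
    from that obtain L L' where "L \<in> C" "s \<in> L" "L' \<in> C" "t \<in> L'" by blast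
    with chain obtain N where "N \<in> C" "s \<in> N" "t \<in> N" by blast
    with sub show ?thesis by blast
  qed
  moreover have "0 \<in> \<Union>C" "b - b * e \<in> \<Union>C" for b
    using ne sub modular_left_idealD(3)[OF mod] by blast+
  moreover have "c *\<^sub>C s \<in> \<Union>C" "b * s \<in> \<Union>C" if "s \<in> \<Union>C" for b c s
    using that sub modular_left_idealD(2)[OF mod] by blast+
  ultimately show ?thesis
    by (simp add: modular_left_ideal_def complex_vector.subspace_def)
qed

lemma ex_maximal_modular_left_ideal:
  assumes "\<nexists>d. d \<star> e = 0"
  shows "\<exists>M. maximal_modular_left_ideal e M"
proof -
  define P where "P = {L. modular_left_ideal e L \<and> e \<notin> L}"
  have "e \<notin> range (\<lambda>b. b - b * e)"
  proof
    assume "e \<in> range (\<lambda>b. b - b * e)"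
    then obtain b where b: "e = b - b * e" by blast
    have "- b \<star> e = e - (b - b * e)"
      by (simp add: circle_def)
    then show False
      using assms b by (metis diff_self)
  qed
  then have "P \<noteq> {}"
    using modular_left_ideal_range unfolding P_def by blast
  moreover have "\<Union>C \<in> P" if "C \<noteq> {}" "subset.chain P C" for C
    using that modular_left_ideal_Union_chain[of C e] unfolding P_def subset_chain_def by blast
  ultimately have "\<exists>M\<in>P. \<forall>L\<in>P. M \<subseteq> L \<longrightarrow> L = M"
    by (rule subset_Zorn_nonempty)
  then show ?thesis
    unfolding P_def maximal_modular_left_ideal_def by blast
qed

text \<open>Near \<open>e\<close> there is no element of a proper \<open>L\<close>: if \<open>u = e - l\<close> is small, then
  \<open>u = w u - w\<close> for some \<open>w\<close>, and modulo \<open>L\<close> the right side is \<open>w e - w = 0\<close>;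
  so \<open>u\<close>, and with it \<open>e\<close>, would be in \<open>L\<close>.\<close>

lemma modular_left_ideal_closure:
  fixes e :: "'a::complex_banach_algebra"
  assumes L: "modular_left_ideal e L"
  shows "modular_left_ideal e (closure L)" and "e \<notin> L \<Longrightarrow> e \<notin> closure L"
proof -
  note Ld = modular_left_idealD[OF L]
  have "a * l \<in> closure L" if l: "l \<in> closure L" for a l
  proof -
    from l obtain u where "\<forall>n. u n \<in> L" "u \<longlonglongrightarrow> l"
      unfolding closure_sequential by blast
    then have "\<forall>n. a * u n \<in> L" "(\<lambda>n. a * u n) \<longlonglongrightarrow> a * l"
      using Ld(2) by (simp_all add: tendsto_mult_left)
    then show ?thesis
      unfolding closure_sequential by (intro exI[of _ "\<lambda>n. a * u n"]) simp
  qed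
  moreover have "a - a * e \<in> closure L" for a
    using Ld(3) closure_subset by blast
  ultimately show "modular_left_ideal e (closure L)"
    using subspace_closure_complex[OF Ld(1)] by (simp add: modular_left_ideal_def)
  show "e \<notin> closure L" if "e \<notin> L"
  proof
    assume "e \<in> closure L"
    then obtain l where l: "l \<in> L" "dist l e < 1"
      unfolding closure_approachable using zero_less_one by blast
    then have "norm (e - l) < 1"
      by (simp add: dist_norm norm_minus_commute)
    then obtain w where "w \<star> (e - l) = 0"
      using small_has_left_quasi_inverse by blast
    then have "e = (l - (w - w * e)) - w * l"
      by (simp add: circle_def algebra_simps)
    also have "\<dots> \<in> L"
      by (rule complex_vector.subspace_diff[OF Ld(1)
            complex_vector.subspace_diff[OF Ld(1) l(1) Ld(3)] Ld(2)[OF l(1)]])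
    finally show False
      using that by contradiction
  qed
qed

lemma closed_maximal_modular_left_ideal:
  assumes "maximal_modular_left_ideal e M"
  shows "closed M"
proof -
  have "closure M = M"
    using assms modular_left_ideal_closure closure_subset
    unfolding maximal_modular_left_ideal_def by metis
  then show ?thesis
    by (metis closed_closure)
qed

context C0_banach_algebra
begin

text \<open>The functions that carry \<open>A\<close> into a maximal \<open>M\<close> form a prime ideal. If \<open>g A\<close> is not
  contained in \<open>M\<close>, then \<open>g A + M\<close> contains \<open>e\<close>; multiplication from the left by \<open>f a\<close> takes
  \<open>g A\<close> to \<open>(f g) A = 0\<close> and \<open>M\<close> to itself, so \<open>(f a) e\<close>, and with it \<open>f a\<close>, belongs to
  \<open>M\<close>. The case \<open>f g = 0\<close> of primeness takes the place of Schur's lemma for the simple module \<open>A/M\<close>.\<close>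

lemma maximal_modular_left_ideal_prime:
  assumes max: "maximal_modular_left_ideal e M"
    and f: "f \<in> C0" and g: "g \<in> C0" and fg: "\<And>x. f x * g x = 0"
    and "act g b \<notin> M"
  shows "act f a \<in> M"
proof -
  have M: "modular_left_ideal e M" and "e \<notin> M"
    using max by (simp_all add: maximal_modular_left_ideal_def)
  note Md = modular_left_idealD[OF M]
  note sub = Md(1)[unfolded complex_vector.subspace_def]
  define L where "L = {act g b + m | b m. m \<in> M}"
  have act0: "act g 0 = 0"
    using act_add_right[OF g, of 0 0] by simp
  have "M \<subseteq> L"
    unfolding L_def using act0 by (force intro: exI[of _ 0])
  have "act g b \<in> L"
    unfolding L_def using sub by force
  have "complex_vector.subspace L"
    unfolding complex_vector.subspace_def
  proof (intro conjI ballI allI)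
    show "0 \<in> L" using \<open>M \<subseteq> L\<close> sub by blast
    show "s + t \<in> L" if st: "s \<in> L" "t \<in> L" for s t
    proof -
      from st obtain b m b' m' where "m \<in> M" "m' \<in> M" "s = act g b + m" "t = act g b' + m'"
        unfolding L_def by blast
      then have "s + t = act g (b + b') + (m + m')" "m + m' \<in> M"
        using sub by (simp_all add: act_add_right[OF g])
      then show ?thesis unfolding L_def by blast
    qed
    show "c *\<^sub>C s \<in> L" if s: "s \<in> L" for c s
    proof -
      from s obtain b m where "m \<in> M" "s = act g b + m"
        unfolding L_def by blast
      then have "c *\<^sub>C s = act g (c *\<^sub>C b) + c *\<^sub>C m" "c *\<^sub>C m \<in> M"
        using sub by (simp_all add: act_scale_right[OF g] scaleC_add_right)
      then show ?thesis unfolding L_def by blast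
    qed
  qed
  moreover have "b * s \<in> L" if s: "s \<in> L" for b s
  proof -
    from s obtain b' m where "m \<in> M" "s = act g b' + m"
      unfolding L_def by blast
    then have "b * s = act g (b * b') + b * m" "b * m \<in> M"
      using Md(2) by (simp_all add: act_mult_right[OF g] distrib_left)
    then show ?thesis unfolding L_def by blast
  qed
  moreover have "b - b * e \<in> L" for b
    using Md(3) \<open>M \<subseteq> L\<close> by blast
  ultimately have "modular_left_ideal e L"
    by (simp add: modular_left_ideal_def)
  moreover have "L \<noteq> M"
    using \<open>act g b \<in> L\<close> \<open>act g b \<notin> M\<close> by blast
  ultimately have "e \<in> L"
    using max \<open>M \<subseteq> L\<close> unfolding maximal_modular_left_ideal_def by blast
  then obtain b' m where m: "m \<in> M" and e: "e = act g b' + m"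
    unfolding L_def by blast
  have "act f a * act g b' = act f (act g (a * b'))"
    by (simp add: act_mult_left[OF f, symmetric] act_mult_right[OF g])
  also have "\<dots> = act (\<lambda>x. 0 * f x) (a * b')"
    using act_mult[OF f g] fg by simp
  also have "\<dots> = 0"
    by (subst act_scale_left[OF f]) simp
  finally have "act f a * e = act f a * m"
    by (simp add: e distrib_left)
  then have "act f a = (act f a - act f a * e) + act f a * m"
    by simp
  also have "\<dots> \<in> M"
    using sub Md(2)[OF m] Md(3) by blast
  finally show ?thesis .
qed

end

text \<open>Hence the functions that carry \<open>A\<close> into \<open>M\<close> have a common zero \<open>x\<close>. Conversely every
  function \<open>f\<close> that is zero near \<open>x\<close> is one of them, by primeness: a bump function \<open>g\<close>
  at \<open>x\<close> with \<open>f g = 0\<close> is not. By soft thresholding it suffices that \<open>f\<close> is zero at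
  \<open>x\<close>.\<close>

lemma maximal_modular_left_ideal_contains_fibre_ideal:
  fixes act :: "('x::t2_space \<Rightarrow> complex) \<Rightarrow> 'a::complex_banach_algebra \<Rightarrow> 'a"
  assumes lc: "locally_compact_space (euclidean :: 'x topology)"
    and "C0_banach_algebra act"
    and max: "maximal_modular_left_ideal e M"
  shows "\<exists>x. fibre_ideal act x \<subseteq> M"
proof -
  interpret C0_banach_algebra act by fact
  have M: "modular_left_ideal e M" and "e \<notin> M"
    using max by (simp_all add: maximal_modular_left_ideal_def)
  have sM: "complex_vector.subspace M" and "closed M"
    using modular_left_idealD(1)[OF M] closed_maximal_modular_left_ideal[OF max] .
  define J where "J = {f \<in> C0. \<forall>a. act f a \<in> M}"
  have zero: "(\<lambda>_. 0) \<in> J"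
  proof -
    have "act (\<lambda>x. 0) a = 0" for a
      using act_scale_left[OF C0_zero, of 0 a] by simp
    then show ?thesis
      using complex_vector.subspace_0[OF sM] by (simp add: J_def C0_zero)
  qed
  have add: "(\<lambda>x. f x + g x) \<in> J" if "f \<in> J" "g \<in> J" for f g
    using that complex_vector.subspace_add[OF sM] by (simp add: J_def C0_add act_add_left)
  have mult: "(\<lambda>x. f x * g x) \<in> J" if f: "f \<in> C0" and g: "g \<in> J" for f g
  proof -
    have "act (\<lambda>x. f x * g x) a \<in> M" for a
    proof -
      have "(\<lambda>x. f x * g x) = (\<lambda>x. g x * f x)"
        by (simp add: mult.commute)
      then show ?thesis
        using g f by (simp add: J_def act_mult)
    qed
    moreover have "(\<lambda>x. f x * g x) \<in> C0"
      using f g by (simp add: J_def C0_mult)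
    ultimately show ?thesis
      by (simp add: J_def)
  qed
  have limit: "f \<in> J" if "f \<in> C0" "\<And>r. r > 0 \<Longrightarrow> (\<lambda>x. soft_threshold r (f x)) \<in> J" for f
    using that act_mem_closed[OF \<open>closed M\<close>] by (simp add: J_def)
  have "J \<noteq> C0"
  proof
    assume "J = C0"
    then have "closure (complex_vector.span {act f a | f a. f \<in> C0}) \<subseteq> M"
      using \<open>closed M\<close> sM by (intro closure_span_subset) (auto simp: J_def)
    with \<open>e \<notin> M\<close> show False
      unfolding act_nondegenerate by blast
  qed
  then obtain x where x: "\<And>f. f \<in> J \<Longrightarrow> f x = 0"
    using C0_ideal_common_zero[of J, OF _ zero add mult limit] unfolding J_def by blast
  have "act f a \<in> M" if f: "f \<in> C0" "f x = 0" for f a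
  proof (rule act_mem_closed[OF \<open>closed M\<close> f(1)])
    fix r :: real assume "r > 0"
    let ?U = "{y. cmod (f y) < r}"
    have "open ?U"
      using C0_continuous[OF f(1)] by (intro open_Collect_less continuous_intros)
    moreover have "x \<in> ?U"
      using f(2) \<open>r > 0\<close> by simp
    ultimately obtain g where g: "g \<in> C0" "g x = 1" "\<And>y. y \<notin> ?U \<Longrightarrow> g y = 0"
      using locally_compact_C0_bump[OF lc] by metis
    have "soft_threshold r (f y) * g y = 0" for y
      using g(3)[of y] soft_threshold_eq_0_iff[OF \<open>r > 0\<close>, of "f y"] by auto
    moreover obtain b where "act g b \<notin> M"
      using x[of g] g by (auto simp: J_def)
    ultimately show "act (\<lambda>x. soft_threshold r (f x)) a \<in> M"
      using maximal_modular_left_ideal_prime[OF max C0_soft_threshold[OF \<open>r > 0\<close> f(1)] g(1)]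
      by blast
  qed
  then show ?thesis
    using fibre_ideal_subset[OF \<open>closed M\<close> sM] by blast
qed


section \<open>Invertibility is a fibrewise property\<close>

text \<open>A left inverse modulo the fibre ideal contained in \<open>M\<close> is a left inverse modulo \<open>M\<close>, which
  puts \<open>e\<close> into \<open>M\<close>.\<close>

lemma left_quasi_inverse_if_fibrewise:
  fixes act :: "('x::t2_space \<Rightarrow> complex) \<Rightarrow> 'a::complex_banach_algebra \<Rightarrow> 'a"
  assumes "locally_compact_space (euclidean :: 'x topology)" and "C0_banach_algebra act"
    and fibres: "\<And>x. \<exists>d. d \<star> e \<in> fibre_ideal act x"
  shows "\<exists>d. d \<star> e = 0"
proof (rule ccontr)
  assume "\<nexists>d. d \<star> e = 0"
  then obtain M where max: "maximal_modular_left_ideal e M"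
    using ex_maximal_modular_left_ideal by blast
  then have M: "modular_left_ideal e M" "e \<notin> M"
    by (simp_all add: maximal_modular_left_ideal_def)
  obtain x where "fibre_ideal act x \<subseteq> M"
    using maximal_modular_left_ideal_contains_fibre_ideal[OF assms(1,2) max] by blast
  with fibres obtain d where "d \<star> e \<in> M" by blast
  moreover have "e = d \<star> e - (d - d * e)"
    by (simp add: circle_def)
  ultimately have "e \<in> M"
    using complex_vector.subspace_diff modular_left_idealD(1,3)[OF M(1)] by metis
  with M(2) show False ..
qed

text \<open>Left ideals only give a left inverse \<open>1 - d\<close> of \<open>1 - e\<close>. But modulo each fibre ideal it is the
  inverse of an invertible element, so the same argument gives \<open>1 - d\<close> a left inverse, which
  has to be \<open>1 - e\<close>.\<close>

lemma quasi_invertible_if_fibrewise: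
  fixes act :: "('x::t2_space \<Rightarrow> complex) \<Rightarrow> 'a::complex_banach_algebra \<Rightarrow> 'a"
  assumes "locally_compact_space (euclidean :: 'x topology)" and act: "C0_banach_algebra act"
    and fibres: "\<And>x. quasi_invertible (fibre_ideal act x) e"
  shows "quasi_invertible {0} e"
proof -
  note ideal = C0_banach_algebra.two_sided_ideal_fibre_ideal[OF act]
  obtain d where d: "d \<star> e = 0"
    using left_quasi_inverse_if_fibrewise[OF assms(1,2), of e] fibres
    unfolding quasi_invertible_def by blast
  have "e \<star> d \<in> fibre_ideal act x" for x
  proof -
    obtain g where "e \<star> g \<in> fibre_ideal act x"
      using fibres[of x] unfolding quasi_invertible_def by blast
    then show ?thesis
      using left_quasi_inverse_is_right[OF ideal, of d e x g] two_sided_idealD(1)[OF ideal] d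
      by simp
  qed
  then obtain f where f: "f \<star> d = 0"
    using left_quasi_inverse_if_fibrewise[OF assms(1,2), of d] by blast
  then have "f = e"
    using circle_assoc[of f d e] d by simp
  with f d show ?thesis
    unfolding quasi_invertible_def by blast
qed


section \<open>The spectral radius as a function of the point\<close>

text \<open>Invertibility of \<open>1 - \<mu> a\<close> is an open condition jointly in \<open>\<mu>\<close> and in the ideal modulo
  which it is meant, as long as the ideals vary lower semicontinuously with \<open>x\<close>: an inverse for
  one pair \<open>(x, \<mu>)\<close> stays an approximate inverse for the neighbouring pairs. A constant family
  of ideals gives the openness of the resolvent set.\<close>

lemma open_quasi_invertible:
  fixes I :: "'x::topological_space \<Rightarrow> 'a::complex_banach_algebra set"
  assumes ideal: "\<And>x. two_sided_ideal (I x)"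
    and approx: "\<And>x j r. j \<in> I x \<Longrightarrow> r > 0 \<Longrightarrow>
      \<exists>s U. norm (j - s) < r \<and> open U \<and> x \<in> U \<and> (\<forall>y\<in>U. s \<in> I y)"
  shows "open {(x, \<mu>). quasi_invertible (I x) (\<mu> *\<^sub>C a)}" (is "open ?W")
  unfolding open_prod_def
proof
  fix p assume "p \<in> ?W"
  then obtain x \<mu> where p: "p = (x, \<mu>)" and "quasi_invertible (I x) (\<mu> *\<^sub>C a)"
    by auto
  then obtain d where d: "d \<star> \<mu> *\<^sub>C a \<in> I x" "\<mu> *\<^sub>C a \<star> d \<in> I x"
    using quasi_invertible_two_sided[OF ideal] by metis
  have half: "(1/2 :: real) > 0" by simp
  obtain s U where s: "norm (d \<star> \<mu> *\<^sub>C a - s) < 1/2"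
    and U: "open U" "x \<in> U" "\<forall>y\<in>U. s \<in> I y"
    using approx[OF d(1) half] by blast
  obtain t V where t: "norm (\<mu> *\<^sub>C a \<star> d - t) < 1/2"
    and V: "open V" "x \<in> V" "\<forall>y\<in>V. t \<in> I y"
    using approx[OF d(2) half] by blast
  \<comment> \<open>The two approximate inverses change by \<open>(\<nu> - \<mu>) (a - d a)\<close> and
    \<open>(\<nu> - \<mu>) (a - a d)\<close> when \<open>\<mu>\<close> is replaced by \<open>\<nu>\<close>; the summand \<open>1\<close> keeps \<open>N\<close>
    positive.\<close>
  define N where "N = norm (a - d * a) + norm (a - a * d) + 1"
  have "N > 0"
    by (simp add: N_def add_nonneg_pos)
  have "quasi_invertible (I y) (\<nu> *\<^sub>C a)"
    if y: "y \<in> U \<inter> V" and \<nu>: "\<nu> \<in> ball \<mu> (1 / (2 * N))" for y \<nu>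
  proof (rule quasi_invertible_if_nearly[OF ideal])
    have small: "norm ((\<nu> - \<mu>) *\<^sub>C b) < 1/2" if "norm b \<le> N" for b :: 'a
    proof -
      have "norm ((\<nu> - \<mu>) *\<^sub>C b) \<le> cmod (\<nu> - \<mu>) * N"
        using that by (simp add: norm_scaleC mult_left_mono)
      also have "\<dots> < 1/2"
        using \<nu> \<open>N > 0\<close> by (simp add: dist_norm norm_minus_commute field_simps)
      finally show ?thesis .
    qed
    have \<nu>a: "\<nu> *\<^sub>C a = \<mu> *\<^sub>C a + (\<nu> - \<mu>) *\<^sub>C a"
      by (simp flip: scaleC_add_left)
    show "s \<in> I y" "t \<in> I y"
      using y U(3) V(3) by auto
    have "d \<star> \<nu> *\<^sub>C a - s = (d \<star> \<mu> *\<^sub>C a - s) + (\<nu> - \<mu>) *\<^sub>C (a - d * a)"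
      unfolding \<nu>a circle_add_right
      by (simp add: mult_scaleC_right complex_vector.scale_right_diff_distrib)
    then have "norm (d \<star> \<nu> *\<^sub>C a - s)
        \<le> norm (d \<star> \<mu> *\<^sub>C a - s) + norm ((\<nu> - \<mu>) *\<^sub>C (a - d * a))"
      by (metis norm_triangle_ineq)
    moreover have "norm (a - d * a) \<le> N"
      by (simp add: N_def)
    ultimately show "norm (d \<star> \<nu> *\<^sub>C a - s) < 1"
      using s small[of "a - d * a"] by simp
    have "\<nu> *\<^sub>C a \<star> d - t = (\<mu> *\<^sub>C a \<star> d - t) + (\<nu> - \<mu>) *\<^sub>C (a - a * d)"
      unfolding \<nu>a circle_add_left
      by (simp add: mult_scaleC_left complex_vector.scale_right_diff_distrib)
    then have "norm (\<nu> *\<^sub>C a \<star> d - t)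
        \<le> norm (\<mu> *\<^sub>C a \<star> d - t) + norm ((\<nu> - \<mu>) *\<^sub>C (a - a * d))"
      by (metis norm_triangle_ineq)
    moreover have "norm (a - a * d) \<le> N"
      by (simp add: N_def)
    ultimately show "norm (\<nu> *\<^sub>C a \<star> d - t) < 1"
      using t small[of "a - a * d"] by simp
  qed
  then have "(U \<inter> V) \<times> ball \<mu> (1 / (2 * N)) \<subseteq> ?W"
    by blast
  moreover have "p \<in> (U \<inter> V) \<times> ball \<mu> (1 / (2 * N))"
    using U(2) V(2) \<open>N > 0\<close> by (simp add: p)
  moreover have "open (U \<inter> V)"
    using U(1) V(1) by (rule open_Int)
  ultimately show "\<exists>A B. open A \<and> open B \<and> p \<in> A \<times> B \<and> A \<times> B \<subseteq> ?W"
    using open_ball by blast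
qed

text \<open>The resolvent set consists of the \<open>c \<noteq> 0\<close> with \<open>1/c\<close> in the open set of the
  preceding lemma, so the spectrum is closed; it is bounded by the norm.\<close>

lemma compact_spectrum:
  assumes I: "two_sided_ideal I"
  shows "compact (spectrum (quotient_alg I) (coset I a))" (is "compact ?S")
proof -
  let ?R = "{\<mu>. quasi_invertible I (\<mu> *\<^sub>C a)}"
  have "open {(x :: complex, \<mu>). quasi_invertible I (\<mu> *\<^sub>C a)}"
  proof (rule open_quasi_invertible[of "\<lambda>_. I"])
    show "\<exists>s U. norm (j - s) < r \<and> open U \<and> x \<in> U \<and> (\<forall>y\<in>U. s \<in> I)"
      if "j \<in> I" "r > 0" for x :: complex and j r
      using that by (intro exI[of _ j] exI[of _ UNIV]) simp
  qed (rule I)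
  then have "open (Pair (0 :: complex) -` {(x, \<mu>). quasi_invertible I (\<mu> *\<^sub>C a)})"
    by (intro open_vimage continuous_intros)
  then have "open ?R"
    by (simp add: vimage_def)
  then have "open (- {0} \<inter> (\<lambda>c. 1 / c) -` ?R)"
    by (intro continuous_open_preimage continuous_intros) auto
  moreover have "- ?S = - {0} \<inter> (\<lambda>c. 1 / c) -` ?R"
  proof (rule Set.set_eqI)
    show "c \<in> - ?S \<longleftrightarrow> c \<in> - {0} \<inter> (\<lambda>c. 1 / c) -` ?R" for c
      using spectrum_quotient_alg[OF I, of c a] zero_mem_spectrum[of "quotient_alg I" "coset I a"]
      by (cases "c = 0") simp_all
  qed
  ultimately have "closed ?S"
    by (simp add: closed_def)
  moreover have "bounded ?S"
    using spectrum_le_if_near_ideal[OF I two_sided_idealD(1)[OF I]] by (auto intro: boundedI)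
  ultimately show ?thesis
    by (simp add: compact_eq_bounded_closed)
qed

lemma spectral_radius_attained:
  assumes I: "two_sided_ideal I"
  obtains c where "c \<in> spectrum (quotient_alg I) (coset I a)"
    and "cmod c = spectral_radius (quotient_alg I) (coset I a)"
proof -
  let ?S = "spectrum (quotient_alg I) (coset I a)"
  have "?S \<noteq> {}"
    using zero_mem_spectrum[of "quotient_alg I" "coset I a"] by blast
  then obtain c where "c \<in> ?S" "\<forall>c'\<in>?S. cmod c' \<le> cmod c"
    using continuous_attains_sup[OF compact_spectrum[OF I] _ continuous_on_norm_id] by blast
  then have "spectral_radius (quotient_alg I) (coset I a) = cmod c"
    unfolding spectral_radius_def by (intro cSup_eq_maximum) auto
  with \<open>c \<in> ?S\<close> that show thesis by metis
qed

text \<open>With \<open>\<mu> = 1/c\<close> the noncompact condition \<open>\<bar>c\<bar> \<ge> r\<close> becomes \<open>\<bar>\<mu>\<bar> \<le> 1/r\<close>, to which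
  the tube lemma applies.\<close>

lemma spectral_radius_less_iff:
  assumes I: "two_sided_ideal I" and "r > 0"
  shows "spectral_radius (quotient_alg I) (coset I a) < r \<longleftrightarrow>
     (\<forall>\<mu>\<in>cball 0 (1 / r). quasi_invertible I (\<mu> *\<^sub>C a))"
proof
  assume less: "spectral_radius (quotient_alg I) (coset I a) < r"
  show "\<forall>\<mu>\<in>cball 0 (1 / r). quasi_invertible I (\<mu> *\<^sub>C a)"
  proof (rule ballI, rule ccontr)
    fix \<mu> :: complex
    assume \<mu>: "\<mu> \<in> cball 0 (1 / r)" and not: "\<not> quasi_invertible I (\<mu> *\<^sub>C a)"
    have "quasi_invertible I (0 *\<^sub>C a)"
      using two_sided_idealD(1)[OF I] by (auto simp: quasi_invertible_def intro: exI[of _ 0])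
    with not have "\<mu> \<noteq> 0" by auto
    then have "1 / \<mu> \<in> spectrum (quotient_alg I) (coset I a)"
      using not spectrum_quotient_alg[OF I, of "1 / \<mu>" a] by simp
    then have "cmod (1 / \<mu>) < r"
      using le_spectral_radius[OF I] less by fastforce
    then show False
      using \<mu> \<open>\<mu> \<noteq> 0\<close> \<open>r > 0\<close> by (simp add: norm_divide field_simps)
  qed
next
  assume inv: "\<forall>\<mu>\<in>cball 0 (1 / r). quasi_invertible I (\<mu> *\<^sub>C a)"
  obtain c where c: "c \<in> spectrum (quotient_alg I) (coset I a)"
    and eq: "cmod c = spectral_radius (quotient_alg I) (coset I a)"
    using spectral_radius_attained[OF I] by metis
  show "spectral_radius (quotient_alg I) (coset I a) < r"
  proof (rule ccontr)
    assume "\<not> spectral_radius (quotient_alg I) (coset I a) < r"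
    then have "r \<le> cmod c" using eq by simp
    then have "c \<noteq> 0" "1 / c \<in> cball 0 (1 / r)"
      using \<open>r > 0\<close> by (auto simp: norm_divide frac_le)
    then show False
      using c inv spectrum_quotient_alg[OF I] by blast
  qed
qed

lemma upper_semicontinuous_spectral_radius_fibre:
  assumes "C0_banach_algebra act"
  shows "upper_semicontinuous (\<lambda>x. spectral_radius (fibre act x) (fibre_map act x a))"
  unfolding upper_semicontinuous_def fibre_def fibre_map_def
proof
  interpret C0_banach_algebra act by fact
  fix r
  let ?\<rho> = "\<lambda>x. spectral_radius (quotient_alg (fibre_ideal act x)) (coset (fibre_ideal act x) a)"
  note ideal = two_sided_ideal_fibre_ideal
  show "open {x. ?\<rho> x < r}"
  proof (cases "r > 0")
    case True
    let ?W = "{(x, \<mu>). quasi_invertible (fibre_ideal act x) (\<mu> *\<^sub>C a)}"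
    have "open ?W"
      using fibre_ideal_approx_nearby by (intro open_quasi_invertible[OF ideal]) metis
    show ?thesis
    proof (subst open_subopen, rule ballI)
      fix x assume "x \<in> {x. ?\<rho> x < r}"
      then have "{x} \<times> cball 0 (1 / r) \<subseteq> ?W"
        using spectral_radius_less_iff[OF ideal True] by auto
      then have "\<exists>U. x \<in> U \<and> open U \<and> U \<times> cball 0 (1 / r) \<subseteq> ?W"
        by (rule Elementary_Topology.tube_lemma[OF compact_cball \<open>open ?W\<close>])
      then obtain U where U: "x \<in> U" "open U" "U \<times> cball 0 (1 / r) \<subseteq> ?W"
        by (elim exE conjE)
      have "U \<subseteq> {x. ?\<rho> x < r}"
        using U(3) spectral_radius_less_iff[OF ideal True] by auto
      with U(1,2) show "\<exists>U. open U \<and> x \<in> U \<and> U \<subseteq> {x. ?\<rho> x < r}"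
        by blast
    qed
  next
    case False
    have "\<not> ?\<rho> x < r" for x
      using False spectral_radius_nonneg[OF ideal, of x a] by linarith
    then have "{x. ?\<rho> x < r} = {}"
      by blast
    then show ?thesis by simp
  qed
qed

text \<open>The spectral radius is at most the norm, and the norm of \<open>a\<close> in the fibres is small off a
  compact set, since \<open>a\<close> is close to an element that is zero in all fibres off that set.\<close>

lemma vanishes_at_infinity_spectral_radius_fibre:
  assumes "C0_banach_algebra act"
  shows "vanishes_at_infinity (\<lambda>x. spectral_radius (fibre act x) (fibre_map act x a))"
  unfolding vanishes_at_infinity_def fibre_def fibre_map_def
proof (intro allI impI)
  interpret C0_banach_algebra act by fact
  fix r :: real assume "r > 0"
  then obtain s K where s: "norm (a - s) < r" and K: "compact K"
    and sK: "\<And>y. y \<notin> K \<Longrightarrow> s \<in> fibre_ideal act y"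
    using fibre_ideal_approx_at_infinity by metis
  note ideal = two_sided_ideal_fibre_ideal
  have "norm (spectral_radius (quotient_alg (fibre_ideal act y)) (coset (fibre_ideal act y) a)) < r"
    if "y \<notin> K" for y
    using spectral_radius_le_if_near_ideal[OF ideal sK[OF that], of a] s
      spectral_radius_nonneg[OF ideal, of y a] by simp
  with K show "\<exists>K. compact K \<and> (\<forall>y. y \<notin> K \<longrightarrow> norm (spectral_radius
      (quotient_alg (fibre_ideal act y)) (coset (fibre_ideal act y) a)) < r)"
    by blast
qed

lemma spectral_radius_type_alg:
  "spectral_radius type_alg a = spectral_radius (quotient_alg {0}) (coset {0} a)"
  by (simp add: spectral_radius_def spectrum_type_alg)

lemma spectral_radius_fibre_le:
  assumes "C0_banach_algebra act"
  shows "spectral_radius (fibre act x) (fibre_map act x a) \<le> spectral_radius type_alg a"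
  unfolding fibre_def fibre_map_def spectral_radius_type_alg
proof -
  interpret C0_banach_algebra act by fact
  let ?I = "fibre_ideal act x"
  note ideal = two_sided_ideal_fibre_ideal
  obtain c where c: "c \<in> spectrum (quotient_alg ?I) (coset ?I a)"
    and eq: "cmod c = spectral_radius (quotient_alg ?I) (coset ?I a)"
    using spectral_radius_attained[OF ideal] by metis
  have "c \<in> spectrum (quotient_alg {0}) (coset {0} a)"
  proof (cases "c = 0")
    case False
    have "{0} \<subseteq> ?I"
      using two_sided_idealD(1)[OF ideal] by simp
    then show ?thesis
      using c quasi_invertible_mono spectrum_quotient_alg[OF ideal False]
        spectrum_quotient_alg[OF two_sided_ideal_zero False] by blast
  qed (simp add: zero_mem_spectrum)
  then show "spectral_radius (quotient_alg ?I) (coset ?I a)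
      \<le> spectral_radius (quotient_alg {0}) (coset {0} a)"
    using le_spectral_radius[OF two_sided_ideal_zero] eq by metis
qed

text \<open>A spectral value of maximal modulus is, if it is not \<open>0\<close>, a spectral value in some
  fibre. If it is \<open>0\<close>, it is one in every fibre.\<close>

lemma spectral_radius_eq_some_fibre:
  fixes act :: "('x::t2_space \<Rightarrow> complex) \<Rightarrow> 'a::complex_banach_algebra \<Rightarrow> 'a"
  assumes "locally_compact_space (euclidean :: 'x topology)" and act: "C0_banach_algebra act"
  shows "\<exists>x. spectral_radius (fibre act x) (fibre_map act x a) = spectral_radius type_alg a"
proof -
  interpret C0_banach_algebra act by fact
  note ideal = two_sided_ideal_fibre_ideal
  obtain c where c: "c \<in> spectrum (quotient_alg {0}) (coset {0} a)"
    and eq: "cmod c = spectral_radius type_alg a"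
    using spectral_radius_attained[OF two_sided_ideal_zero] spectral_radius_type_alg by metis
  have "\<exists>x. c \<in> spectrum (fibre act x) (fibre_map act x a)"
  proof (cases "c = 0")
    case False
    then have "\<not> quasi_invertible {0} ((1/c) *\<^sub>C a)"
      using c spectrum_quotient_alg[OF two_sided_ideal_zero] by blast
    then obtain x where "\<not> quasi_invertible (fibre_ideal act x) ((1/c) *\<^sub>C a)"
      using quasi_invertible_if_fibrewise[OF assms] by blast
    then show ?thesis
      unfolding fibre_def fibre_map_def using spectrum_quotient_alg[OF ideal False] by blast
  qed (simp add: zero_mem_spectrum)
  then obtain x where "cmod c \<le> spectral_radius (fibre act x) (fibre_map act x a)"
    using le_spectral_radius[OF ideal] unfolding fibre_def fibre_map_def by blast
  then show ?thesis
    using spectral_radius_fibre_le[OF act, of x a] eq by (intro exI[of _ x]) simp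
qed

theorem proposition1p12:
  fixes act :: "('x::t2_space \<Rightarrow> complex) \<Rightarrow> 'a::complex_banach_algebra \<Rightarrow> 'a"
  assumes "locally_compact_space (euclidean :: 'x topology)"
    and "C0_banach_algebra act"
  shows "(\<forall>a. upper_semicontinuous (\<lambda>x. spectral_radius (fibre act x) (fibre_map act x a)) \<and>
              vanishes_at_infinity (\<lambda>x. spectral_radius (fibre act x) (fibre_map act x a))) \<and>
         (second_countable (euclidean :: 'x topology) \<longrightarrow>
           (\<forall>a. (\<exists>x. spectral_radius (fibre act x) (fibre_map act x a) = spectral_radius type_alg a) \<and>
                (\<forall>x. spectral_radius (fibre act x) (fibre_map act x a) \<le> spectral_radius type_alg a)))"
  by (intro conjI allI impI upper_semicontinuous_spectral_radius_fibre
      vanishes_at_infinity_spectral_radius_fibre spectral_radius_eq_some_fibre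
      spectral_radius_fibre_le assms)

end
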